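(* Let $\mathcal{L}$ be a time-dependent quasi-Lie bracket on $\mathbb{H}^n$ with Jacobiator $\mathcal{J}_t$ satisfying $\|\mathcal{J}_t(x,y,z)\|\le 6C_2\|x\|\|y\|\|z\|$, suppose the Carathéodory regularity assumption holds, and let $\mathcal{X}=\{x\in\mathbb{H}^n:\|x\|\le M_{\mathcal X}\}$ be a closed ball centered at the origin. Then the projected Jacobi defect $\delta$ satisfies the generalized one-sided Lipschitz (GOSL) bound: for all $x,z\in\mathcal{X}$ and all $t\ge 0$, $$\langle \delta(x,t)-\delta(z,t),\,x-z\rangle_{\mathbb{R}}\le \rho_\delta^{\mathrm{tight}}\|x-z\|^2+\ell_\delta^{\mathrm{tight}}\|x-z\|,$$ with the tight constants $$\rho_\delta^{\mathrm{tight}}=2\rho_\delta,\qquad \ell_\delta^{\mathrm{tight}}=4\bar\delta_{\max},\qquad \rho_\delta:=6C_2(M_{\mathcal X}+\varepsilon^* )(3M_{\mathcal X}+\varepsilon^* ).$$ The factor $2$ in $\rho_\delta^{\mathrm{tight}}$ and the factor $4$ in $\ell_\delta^{\mathrm{tight}}$ arise from the sub-optimality gap of the state-dependent measurable selection $\xi^*(\cdot,t)$; they collapse to $1$ (so that the constants become $\rho_\delta$ and $\bar\delta_{\max}$) when $\xi^*$ admits a state-independent maximizer. The quantity $\rho_\delta$ is the base (non-tight) trilinear coefficient.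
   Context: $\mathbb{H}$ denotes the quaternions. On $\mathbb{H}^n$ put $\langle x,y\rangle_{\mathbb R}=\mathrm{Re}\big(\sum_i\bar x_iy_i\big)$ and $\|x\|=\sqrt{\langle x,x\rangle_{\mathbb R}}$. Quasi-Lie bracket: a family $\mathcal L(\cdot,\cdot,t):\mathbb{H}^n\times\mathbb{H}^n\to\mathbb{H}^n$, $t\ge0$, of $\mathbb{R}$-bilinear skew-symmetric maps whose Jacobiator $\mathcal J_t(x,y,z)=\mathcal L(x,\mathcal L(y,z,t),t)+\mathcal L(y,\mathcal L(z,x,t),t)+\mathcal L(z,\mathcal L(x,y,t),t)$ satisfies $\|\mathcal J_t(x,y,z)\|\le 6C_2\|x\|\|y\|\|z\|$ uniformly in $t\ge0$, for some $C_2>0$. Projection: $B\in\mathbb{H}^{n\times m}$ has full column rank $m$, $\mathrm{Im}(B)=\{Bu:u\in\mathbb{H}^m\}$, and $\Pi_{\mathrm{Im}(B)}$ is the orthogonal projection of $\mathbb{H}^n$ onto $\mathrm{Im}(B)$ with respect to $\langle\cdot,\cdot\rangle_{\mathbb R}$. Constants: $A>0$, $C_1\ge0$, $\varepsilon_0>0$ are fixed bracket constants and $\varepsilon^*=\min\{1/(16A),\sqrt{1/(16C_1)},1/(4C_2),\varepsilon_0\}$ (with $\sqrt{1/0}:=+\infty$). Here $A$ is the bilinear bound, $\|\mathcal L(x,y)\|\le A\|x\|\|y\|$ on the ball of radius $\varepsilon_0$, and $C_1$ is the antisymmetry-defect constant, $\|\mathcal L(x,y)+\mathcal L(y,x)\|\le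 C_1\|x\|\|y\|(\|x\|+\|y\|)$ (one may take $C_1=0$ when $\mathcal L$ is exactly antisymmetric). Carathéodory regularity: $(x,\xi_1,\xi_2,t)\mapsto\mathcal J_t(x,x+\xi_1,x+\xi_2)$ is continuous in $(x,\xi_1,\xi_2)$ for each fixed $t$ and Lebesgue measurable in $t$ for each fixed $(x,\xi_1,\xi_2)$. Projected Jacobi defect: $\xi^*(x,t)=(\xi_1^*(x,t),\xi_2^*(x,t))$ is a jointly measurable selection of maximizers of $(\xi_1,\xi_2)\mapsto\|\Pi_{\mathrm{Im}(B)}\mathcal J_t(x,x+\xi_1,x+\xi_2)\|$ over $\|\xi_1\|,\|\xi_2\|\le\varepsilon^*$, and $\delta(x,t)=\Pi_{\mathrm{Im}(B)}\big[\mathcal J_t(x,x+\xi_1^*(x,t),x+\xi_2^*(x,t))\big]$. $M_{\mathcal X}^{\mathrm{prior}}$ is an a priori bound for the norms of points of $\mathcal X$ (so $M_{\mathcal X}\le M_{\mathcal X}^{\mathrm{prior}}$), and $\bar\delta_{\max}=6C_2M_{\mathcal X}^{\mathrm{prior}}(M_{\mathcal X}^{\mathrm{prior}}+\varepsilon^* )^2$. *)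

theory Defs
  imports "HOL-Analysis.Analysis"
begin

section \<open>The quaternions as a Euclidean space\<close>

datatype quat = Quat (qRe: real) (qIm1: real) (qIm2: real) (qIm3: real)

lemma quat_eq_iff:
  "x = y \<longleftrightarrow> qRe x = qRe y \<and> qIm1 x = qIm1 y \<and> qIm2 x = qIm2 y \<and> qIm3 x = qIm3 y"
  by (cases x; cases y) simp

instantiation quat :: real_algebra_1
begin

definition zero_quat :: quat
  where "0 = Quat 0 0 0 0"

definition one_quat :: quat
  where "1 = Quat 1 0 0 0"

definition plus_quat :: "quat \<Rightarrow> quat \<Rightarrow> quat"
  where "x + y = Quat (qRe x + qRe y) (qIm1 x + qIm1 y) (qIm2 x + qIm2 y) (qIm3 x + qIm3 y)"

definition uminus_quat :: "quat \<Rightarrow> quat"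
  where "- x = Quat (- qRe x) (- qIm1 x) (- qIm2 x) (- qIm3 x)"

definition minus_quat :: "quat \<Rightarrow> quat \<Rightarrow> quat"
  where "x - y = Quat (qRe x - qRe y) (qIm1 x - qIm1 y) (qIm2 x - qIm2 y) (qIm3 x - qIm3 y)"

definition scaleR_quat :: "real \<Rightarrow> quat \<Rightarrow> quat"
  where "r *\<^sub>R x = Quat (r * qRe x) (r * qIm1 x) (r * qIm2 x) (r * qIm3 x)"

definition times_quat :: "quat \<Rightarrow> quat \<Rightarrow> quat"
  where "x * y = Quat
    (qRe x * qRe y - qIm1 x * qIm1 y - qIm2 x * qIm2 y - qIm3 x * qIm3 y)
    (qRe x * qIm1 y + qIm1 x * qRe y + qIm2 x * qIm3 y - qIm3 x * qIm2 y)
    (qRe x * qIm2 y - qIm1 x * qIm3 y + qIm2 x * qRe y + qIm3 x * qIm1 y)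
    (qRe x * qIm3 y + qIm1 x * qIm2 y - qIm2 x * qIm1 y + qIm3 x * qRe y)"

lemma quat_sel_simps [simp]:
  "qRe 0 = 0" "qIm1 0 = 0" "qIm2 0 = 0" "qIm3 0 = 0"
  "qRe 1 = 1" "qIm1 1 = 0" "qIm2 1 = 0" "qIm3 1 = 0"
  "qRe (x + y) = qRe x + qRe y" "qIm1 (x + y) = qIm1 x + qIm1 y"
  "qIm2 (x + y) = qIm2 x + qIm2 y" "qIm3 (x + y) = qIm3 x + qIm3 y"
  "qRe (- x) = - qRe x" "qIm1 (- x) = - qIm1 x"
  "qIm2 (- x) = - qIm2 x" "qIm3 (- x) = - qIm3 x"
  "qRe (x - y) = qRe x - qRe y" "qIm1 (x - y) = qIm1 x - qIm1 y"
  "qIm2 (x - y) = qIm2 x - qIm2 y" "qIm3 (x - y) = qIm3 x - qIm3 y"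
  "qRe (r *\<^sub>R x) = r * qRe x" "qIm1 (r *\<^sub>R x) = r * qIm1 x"
  "qIm2 (r *\<^sub>R x) = r * qIm2 x" "qIm3 (r *\<^sub>R x) = r * qIm3 x"
  "qRe (x * y) = qRe x * qRe y - qIm1 x * qIm1 y - qIm2 x * qIm2 y - qIm3 x * qIm3 y"
  "qIm1 (x * y) = qRe x * qIm1 y + qIm1 x * qRe y + qIm2 x * qIm3 y - qIm3 x * qIm2 y"
  "qIm2 (x * y) = qRe x * qIm2 y - qIm1 x * qIm3 y + qIm2 x * qRe y + qIm3 x * qIm1 y"
  "qIm3 (x * y) = qRe x * qIm3 y + qIm1 x * qIm2 y - qIm2 x * qIm1 y + qIm3 x * qRe y"
  by (simp_all add: zero_quat_def one_quat_def plus_quat_def uminus_quat_def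
      minus_quat_def scaleR_quat_def times_quat_def)

instance
proof
  fix x y z :: quat and a b :: real
  show "x * y * z = x * (y * z)"
    unfolding quat_eq_iff quat_sel_simps by (intro conjI; algebra)
  show "(x + y) * z = x * z + y * z" "x * (y + z) = x * y + x * z"
    unfolding quat_eq_iff quat_sel_simps by (intro conjI; algebra)+
  show "(a *\<^sub>R x) * y = a *\<^sub>R (x * y)" "x * (a *\<^sub>R y) = a *\<^sub>R (x * y)"
    unfolding quat_eq_iff quat_sel_simps by (intro conjI; algebra)+
qed (auto simp: quat_eq_iff distrib_left distrib_right)

end

definition qcnj :: "quat \<Rightarrow> quat"
  where "qcnj x = Quat (qRe x) (- qIm1 x) (- qIm2 x) (- qIm3 x)"

instantiation quat :: real_inner
begin

definition inner_quat :: "quat \<Rightarrow> quat \<Rightarrow> real"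
  where "x \<bullet> y = qRe (qcnj x * y)"

definition norm_quat :: "quat \<Rightarrow> real"
  where "norm x = sqrt (x \<bullet> (x :: quat))"

definition sgn_quat :: "quat \<Rightarrow> quat"
  where "sgn x = (x :: quat) /\<^sub>R norm x"

definition dist_quat :: "quat \<Rightarrow> quat \<Rightarrow> real"
  where "dist x y = norm (x - y :: quat)"

definition uniformity_quat :: "(quat \<times> quat) filter"
  where "uniformity = (INF e\<in>{0 <..}. principal {(x :: quat, y). dist x y < e})"

definition open_quat :: "quat set \<Rightarrow> bool"
  where "open U \<longleftrightarrow> (\<forall>x\<in>U. eventually (\<lambda>(x', y). x' = x \<longrightarrow> y \<in> U) (uniformity :: (quat \<times> quat) filter))"

lemma inner_quat_coords:
  "x \<bullet> y = qRe x * qRe y + qIm1 x * qIm1 y + qIm2 x * qIm2 y + qIm3 x * qIm3 y"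
  by (simp add: inner_quat_def qcnj_def)

instance
proof
  fix x y z :: quat and r :: real
  show "x \<bullet> y = y \<bullet> x" "(x + y) \<bullet> z = x \<bullet> z + y \<bullet> z" "(r *\<^sub>R x) \<bullet> y = r * (x \<bullet> y)"
    by (simp_all add: inner_quat_coords algebra_simps)
  show "0 \<le> x \<bullet> x"
    by (simp add: inner_quat_coords)
  show "x \<bullet> x = 0 \<longleftrightarrow> x = 0"
    unfolding inner_quat_coords quat_eq_iff power2_eq_square [symmetric]
    by (auto simp: add_nonneg_eq_0_iff)
qed (rule norm_quat_def sgn_quat_def dist_quat_def uniformity_quat_def open_quat_def)+

end

instantiation quat :: euclidean_space
begin

definition Basis_quat :: "quat set"
  where "Basis = {Quat 1 0 0 0, Quat 0 1 0 0, Quat 0 0 1 0, Quat 0 0 0 1}"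

instance
proof
  fix u v :: quat
  show "(Basis :: quat set) \<noteq> {}" "finite (Basis :: quat set)"
    by (simp_all add: Basis_quat_def)
  show "u \<bullet> v = (if u = v then 1 else 0)" if uv: "u \<in> Basis" "v \<in> Basis"
  proof -
    have "u = Quat 1 0 0 0 \<or> u = Quat 0 1 0 0 \<or> u = Quat 0 0 1 0 \<or> u = Quat 0 0 0 1"
         "v = Quat 1 0 0 0 \<or> v = Quat 0 1 0 0 \<or> v = Quat 0 0 1 0 \<or> v = Quat 0 0 0 1"
      using uv by (simp_all only: Basis_quat_def insert_iff empty_iff simp_thms)
    then show ?thesis
      by (elim disjE) (simp_all add: inner_quat_coords)
  qed
  show "(\<forall>v\<in>Basis. u \<bullet> v = 0) \<longleftrightarrow> u = 0"
    by (simp add: Basis_quat_def inner_quat_coords) (simp add: quat_eq_iff)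
qed

end

text \<open>
  Consequently the library inner product and norm of the type \<open>quat ^ 'n\<close> are those of
  \<open>H^n\<close>.
\<close>

lemma inner_quat_vec:
  fixes x y :: "quat ^ 'n"
  shows "x \<bullet> y = qRe (\<Sum>i\<in>UNIV. qcnj (x $ i) * y $ i)"
proof -
  have "qRe (\<Sum>i\<in>A. f i) = (\<Sum>i\<in>A. qRe (f i))" for A :: "'n set" and f
    by (induction A rule: infinite_finite_induct) auto
  then show ?thesis
    by (simp add: inner_vec_def inner_quat_def)
qed

lemma norm_quat_vec:
  fixes x :: "quat ^ 'n"
  shows "norm x = sqrt (qRe (\<Sum>i\<in>UNIV. qcnj (x $ i) * x $ i))"
  by (simp add: norm_eq_sqrt_inner inner_quat_vec)


section \<open>Column rank and projection\<close>

text \<open>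
  \<open>H^n\<close> is a right module: \<open>B *v u\<close> is the combination of the columns of \<open>B\<close> with the
  coefficients \<open>u $ j\<close> on the right.  Hence linear independence of columns and the column
  rank are taken with respect to right multiplication.
\<close>

definition right_independent_columns :: "quat ^ 'm ^ 'n \<Rightarrow> 'm set \<Rightarrow> bool"
  where "right_independent_columns B J \<longleftrightarrow>
    (\<forall>c. (\<forall>i. (\<Sum>j\<in>J. B $ i $ j * c j) = 0) \<longrightarrow> (\<forall>j\<in>J. c j = 0))"

definition column_rank :: "quat ^ 'm ^ 'n \<Rightarrow> nat"
  where "column_rank B = Max {card J |J. right_independent_columns B J}"

lemma right_independent_columns_UNIV:
  fixes B :: "quat ^ 'm ^ 'n"
  shows "right_independent_columns B UNIV \<longleftrightarrow> (\<forall>u. B *v u = 0 \<longrightarrow> u = 0)"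
proof
  assume *: "right_independent_columns B UNIV"
  show "\<forall>u. B *v u = 0 \<longrightarrow> u = 0"
  proof (intro allI impI)
    fix u assume "B *v u = 0"
    with * have "\<forall>j\<in>UNIV. u $ j = 0"
      unfolding right_independent_columns_def
      by (auto simp: vec_eq_iff matrix_vector_mult_def)
    then show "u = 0" by (simp add: vec_eq_iff)
  qed
next
  assume *: "\<forall>u. B *v u = 0 \<longrightarrow> u = 0"
  show "right_independent_columns B UNIV"
    unfolding right_independent_columns_def
  proof (intro allI impI)
    fix c assume "\<forall>i. (\<Sum>j\<in>UNIV. B $ i $ j * c j) = 0"
    then have "B *v (\<chi> j. c j) = 0"
      by (simp add: vec_eq_iff matrix_vector_mult_def)
    with * have "(\<chi> j. c j) = 0" by blast
    then show "\<forall>j\<in>UNIV. c j = 0" by (simp add: vec_eq_iff)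
  qed
qed

lemma full_column_rank_iff:
  fixes B :: "quat ^ 'm ^ 'n"
  shows "column_rank B = CARD('m) \<longleftrightarrow> (\<forall>u. B *v u = 0 \<longrightarrow> u = 0)"
proof -
  let ?S = "{card J |J. right_independent_columns B J}"
  have le: "\<And>k. k \<in> ?S \<Longrightarrow> k \<le> CARD('m)"
    by (auto intro: card_mono)
  then have fin: "finite ?S"
    by (meson finite_nat_set_iff_bounded_le)
  have "right_independent_columns B {}"
    by (simp add: right_independent_columns_def)
  then have ne: "?S \<noteq> {}" by blast
  have "column_rank B = CARD('m) \<longleftrightarrow> CARD('m) \<in> ?S"
  proof
    assume "column_rank B = CARD('m)"
    then show "CARD('m) \<in> ?S"
      using Max_in [OF fin ne] by (simp add: column_rank_def)
  next
    assume "CARD('m) \<in> ?S"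
    then show "column_rank B = CARD('m)"
      unfolding column_rank_def by (intro Max_eqI fin le)
  qed
  also have "\<dots> \<longleftrightarrow> right_independent_columns B UNIV"
  proof
    assume "CARD('m) \<in> ?S"
    then obtain J where J: "card J = CARD('m)" "right_independent_columns B J"
      by force
    then have "J = UNIV"
      by (intro card_subset_eq) auto
    with J show "right_independent_columns B UNIV" by simp
  qed blast
  finally show ?thesis
    by (simp add: right_independent_columns_UNIV)
qed

definition orth_proj :: "'a :: real_inner set \<Rightarrow> 'a \<Rightarrow> 'a"
  where "orth_proj S x = (THE p. p \<in> S \<and> (\<forall>s\<in>S. (x - p) \<bullet> s = 0))"

lemma orth_proj_unique:
  fixes S :: "'a :: real_inner set"
  assumes "subspace S" "p \<in> S" "\<forall>s\<in>S. (x - p) \<bullet> s = 0"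
  shows "orth_proj S x = p"
  unfolding orth_proj_def
proof (rule the_equality)
  fix q assume q: "q \<in> S \<and> (\<forall>s\<in>S. (x - q) \<bullet> s = 0)"
  have "q - p \<in> S"
    using assms q by (simp add: subspace_diff)
  then have "(x - p) \<bullet> (q - p) = 0" "(x - q) \<bullet> (q - p) = 0"
    using assms q by auto
  then have "(q - p) \<bullet> (q - p) = 0"
    by (simp add: inner_diff_left)
  then show "q = p" by simp
qed (use assms in auto)

lemma orth_proj:
  fixes S :: "'a :: euclidean_space set"
  assumes "subspace S"
  shows "orth_proj S x \<in> S" "\<And>s. s \<in> S \<Longrightarrow> (x - orth_proj S x) \<bullet> s = 0"
proof -
  obtain y z where "y \<in> span S" "\<And>w. w \<in> span S \<Longrightarrow> orthogonal z w" "x = y + z"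
    using orthogonal_subspace_decomp_exists [of S x] by blast
  then have yz: "y \<in> S" "\<forall>s\<in>S. (x - y) \<bullet> s = 0"
    using assms span_eq_iff [THEN iffD2, OF assms] by (auto simp: orthogonal_def)
  then have "orth_proj S x = y"
    by (rule orth_proj_unique [OF assms])
  with yz show "orth_proj S x \<in> S" "\<And>s. s \<in> S \<Longrightarrow> (x - orth_proj S x) \<bullet> s = 0"
    by auto
qed

lemma subspace_image_matrix:
  fixes B :: "quat ^ 'm ^ 'n"
  shows "subspace (range ((*v) B))"
proof -
  have "linear ((*v) B)"
    by (rule linearI)
      (simp_all add: vec_eq_iff matrix_vector_mult_def distrib_left sum.distrib scaleR_sum_right)
  then show ?thesis
    by (simp add: linear_subspace_image)
qed


section \<open>Quasi-Lie brackets and the projected Jacobi defect\<close>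

type_synonym 'n bracket = "quat ^ 'n \<Rightarrow> quat ^ 'n \<Rightarrow> real \<Rightarrow> quat ^ 'n"

definition jacobiator ::
    "('n::finite) bracket \<Rightarrow> real \<Rightarrow> quat ^ 'n \<Rightarrow> quat ^ 'n \<Rightarrow> quat ^ 'n \<Rightarrow> quat ^ 'n"
  where "jacobiator L t x y z = L x (L y z t) t + L y (L z x t) t + L z (L x y t) t"

definition quasi_lie_bracket :: "('n::finite) bracket \<Rightarrow> real \<Rightarrow> bool"
  where "quasi_lie_bracket L C2 \<longleftrightarrow> C2 > 0 \<and>
    (\<forall>t\<ge>0. bilinear (\<lambda>x y. L x y t) \<and>
      (\<forall>x y. L x y t = - L y x t) \<and>
      (\<forall>x y z. norm (jacobiator L t x y z) \<le> 6 * C2 * norm x * norm y * norm z))"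

definition bracket_constants :: "('n::finite) bracket \<Rightarrow> real \<Rightarrow> real \<Rightarrow> real \<Rightarrow> bool"
  where "bracket_constants L A C1 \<epsilon>0 \<longleftrightarrow> A > 0 \<and> C1 \<ge> 0 \<and> \<epsilon>0 > 0 \<and>
    (\<forall>t\<ge>0. \<forall>x\<in>ball 0 \<epsilon>0. \<forall>y\<in>ball 0 \<epsilon>0.
      norm (L x y t) \<le> A * norm x * norm y \<and>
      norm (L x y t + L y x t) \<le> C1 * norm x * norm y * (norm x + norm y))"

text \<open>
  The case distinction implements the convention \<open>\<surd>(1/0) = +\<infinity>\<close>; in HOL \<open>1 / 0 = 0\<close>.
\<close>

definition eps_star :: "real \<Rightarrow> real \<Rightarrow> real \<Rightarrow> real \<Rightarrow> real"
  where "eps_star A C1 C2 \<epsilon>0 =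
    Min ({1 / (16 * A), 1 / (4 * C2), \<epsilon>0} \<union> (if C1 = 0 then {} else {sqrt (1 / (16 * C1))}))"

definition caratheodory :: "('n::finite) bracket \<Rightarrow> bool"
  where "caratheodory L \<longleftrightarrow>
    (\<forall>t\<ge>0. continuous_on UNIV (\<lambda>(x, \<xi>1, \<xi>2). jacobiator L t x (x + \<xi>1) (x + \<xi>2))) \<and>
    (\<forall>x \<xi>1 \<xi>2. (\<lambda>t. jacobiator L t x (x + \<xi>1) (x + \<xi>2))
      \<in> borel_measurable (lebesgue_on {0..}))"

definition projected_jacobiator ::
    "('n::finite) bracket \<Rightarrow> quat ^ 'm ^ 'n \<Rightarrow> real \<Rightarrow> quat ^ 'n \<Rightarrow> (quat ^ 'n) \<times> (quat ^ 'n) \<Rightarrow> quat ^ 'n"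
  where "projected_jacobiator L B t x = (\<lambda>(\<xi>1, \<xi>2).
    orth_proj (range ((*v) B)) (jacobiator L t x (x + \<xi>1) (x + \<xi>2)))"

definition is_maximizer ::
    "('n::finite) bracket \<Rightarrow> quat ^ 'm ^ 'n \<Rightarrow> real \<Rightarrow> real \<Rightarrow> quat ^ 'n \<Rightarrow> (quat ^ 'n) \<times> (quat ^ 'n) \<Rightarrow> bool"
  where "is_maximizer L B \<epsilon> t x =
    is_arg_max (\<lambda>\<xi>. norm (projected_jacobiator L B t x \<xi>)) (\<lambda>(\<xi>1, \<xi>2). norm \<xi>1 \<le> \<epsilon> \<and> norm \<xi>2 \<le> \<epsilon>)"

text \<open>Joint measurability is Borel in the state and Lebesgue in the time.\<close>

definition maximizing_selection ::
    "('n::finite) bracket \<Rightarrow> quat ^ 'm ^ 'n \<Rightarrow> real \<Rightarrow>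
      (quat ^ 'n \<Rightarrow> real \<Rightarrow> (quat ^ 'n) \<times> (quat ^ 'n)) \<Rightarrow> bool"
  where "maximizing_selection L B \<epsilon> \<xi> \<longleftrightarrow>
    (\<lambda>(x, t). \<xi> x t) \<in> borel_measurable (borel \<Otimes>\<^sub>M lebesgue_on {0..}) \<and>
    (\<forall>x. \<forall>t\<ge>0. is_maximizer L B \<epsilon> t x (\<xi> x t))"

definition jacobi_defect ::
    "('n::finite) bracket \<Rightarrow> quat ^ 'm ^ 'n \<Rightarrow>
      (quat ^ 'n \<Rightarrow> real \<Rightarrow> (quat ^ 'n) \<times> (quat ^ 'n)) \<Rightarrow> quat ^ 'n \<Rightarrow> real \<Rightarrow> quat ^ 'n"
  where "jacobi_defect L B \<xi> x t = projected_jacobiator L B t x (\<xi> x t)"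

definition GOSL :: "('a::real_inner) set \<Rightarrow> ('a \<Rightarrow> real \<Rightarrow> 'a) \<Rightarrow> real \<Rightarrow> real \<Rightarrow> bool"
  where "GOSL X \<delta> \<rho> l \<longleftrightarrow> (\<forall>x\<in>X. \<forall>z\<in>X. \<forall>t\<ge>0.
    (\<delta> x t - \<delta> z t) \<bullet> (x - z) \<le> \<rho> * (norm (x - z))\<^sup>2 + l * norm (x - z))"

definition delta_max_bar :: "real \<Rightarrow> real \<Rightarrow> real \<Rightarrow> real"
  where "delta_max_bar C2 Mprior \<epsilon> = 6 * C2 * Mprior * (Mprior + \<epsilon>)\<^sup>2"

definition rho_delta :: "real \<Rightarrow> real \<Rightarrow> real \<Rightarrow> real"
  where "rho_delta C2 M \<epsilon> = 6 * C2 * (M + \<epsilon>) * (3 * M + \<epsilon>)"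

end

theory Submission
  imports Defs
begin

text \<open>
  The general bound and the one for a state-independent perturbation rest on estimates of different
  nature; both use that an orthogonal projection does not increase norms.

  If the perturbation \<open>(\<xi>1, \<xi>2)\<close> is the same at \<open>x\<close> and at \<open>z\<close>, the three arguments
  \<open>x\<close>, \<open>x + \<xi>1\<close>, \<open>x + \<xi>2\<close> of the Jacobiator all move by \<open>x - z\<close>.  As the Jacobiator is trilinear,
  its increment telescopes into three terms, each with \<open>x - z\<close> in one slot.  The trilinear
  bound then gives the Lipschitz constant
  \<open>6 C2 ((M + \<epsilon>)\<^sup>2 + 2 M (M + \<epsilon>)) = 6 C2 (M + \<epsilon>) (3 M + \<epsilon>)\<close>, which is exactly
  \<open>rho_delta\<close>; the projection, being linear, preserves this estimate
  (lemma \<open>norm_projected_jacobiator_diff_le\<close>).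

  If the perturbation varies with the state, nothing controls how far a maximizer jumps between
  \<open>x\<close> and \<open>z\<close>, however close they are.  What remains is the size of the defect, at most
  \<open>delta_max_bar\<close> at each of the two points (lemma \<open>norm_projected_jacobiator_le\<close>), so
  the jump costs at most \<open>2 * delta_max_bar * norm (x - z)\<close> in the inner product.  This lies within
  the additive term, and the quadratic term is nonnegative.
\<close>

lemma orth_proj_diff:
  fixes S :: "'a::euclidean_space set"
  assumes "subspace S"
  shows "orth_proj S (x - y) = orth_proj S x - orth_proj S y"
proof (rule orth_proj_unique [OF assms])
  show "orth_proj S x - orth_proj S y \<in> S"
    using assms by (simp add: orth_proj(1) subspace_diff)
  have "(x - y - (orth_proj S x - orth_proj S y)) \<bullet> s
      = (x - orth_proj S x) \<bullet> s - (y - orth_proj S y) \<bullet> s" for s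
    by (simp add: inner_diff_left)
  then show "\<forall>s\<in>S. (x - y - (orth_proj S x - orth_proj S y)) \<bullet> s = 0"
    using orth_proj(2) [OF assms] by simp
qed

text \<open>
  Orthogonality of the residual to the projection \<open>p\<close> gives \<open>p \<bullet> p = x \<bullet> p\<close>, and
  Cauchy--Schwarz does the rest.
\<close>

lemma norm_orth_proj_le:
  fixes S :: "'a::euclidean_space set"
  assumes "subspace S"
  shows "norm (orth_proj S x) \<le> norm x"
proof -
  let ?p = "orth_proj S x"
  have "(x - ?p) \<bullet> ?p = 0"
    by (intro orth_proj assms)
  then have "norm ?p * norm ?p = x \<bullet> ?p"
    by (simp add: inner_diff_left dot_square_norm power2_eq_square)
  also have "\<dots> \<le> norm x * norm ?p"
    by (rule norm_cauchy_schwarz)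
  finally show ?thesis
    by (cases "?p = 0") auto
qed

lemma jacobiator_diff:
  assumes "bilinear (\<lambda>x y. L x y t)"
  shows "jacobiator L t x y w - jacobiator L t x' y' w'
    = jacobiator L t (x - x') y w + jacobiator L t x' (y - y') w + jacobiator L t x' y' (w - w')"
  using bilinear_lsub [OF assms] bilinear_rsub [OF assms]
  by (simp add: jacobiator_def)

lemma norm_jacobiator_le:
  assumes "quasi_lie_bracket L C2" "t \<ge> 0" "norm x \<le> a" "norm y \<le> b" "norm z \<le> c"
  shows "norm (jacobiator L t x y z) \<le> 6 * C2 * a * b * c"
proof -
  have "C2 > 0" and "norm (jacobiator L t x y z) \<le> 6 * C2 * norm x * norm y * norm z"
    using assms by (auto simp: quasi_lie_bracket_def)
  have nonneg: "a \<ge> 0" "b \<ge> 0" "c \<ge> 0"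
    using assms(3-5) by (auto intro: order_trans [OF norm_ge_zero])
  note \<open>norm (jacobiator L t x y z) \<le> 6 * C2 * norm x * norm y * norm z\<close>
  also have "6 * C2 * norm x * norm y * norm z \<le> 6 * C2 * a * b * c"
    using assms(3-5) \<open>C2 > 0\<close> nonneg by (intro mult_mono) auto
  finally show ?thesis .
qed

lemma norm_projected_jacobiator_le:
  assumes "quasi_lie_bracket L C2" "t \<ge> 0" "norm x \<le> M"
    and "norm \<xi>1 \<le> \<epsilon>" "norm \<xi>2 \<le> \<epsilon>"
  shows "norm (projected_jacobiator L B t x (\<xi>1, \<xi>2)) \<le> delta_max_bar C2 M \<epsilon>"
proof -
  have "norm (projected_jacobiator L B t x (\<xi>1, \<xi>2))
      \<le> norm (jacobiator L t x (x + \<xi>1) (x + \<xi>2))"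
    by (simp add: projected_jacobiator_def norm_orth_proj_le subspace_image_matrix)
  also have "\<dots> \<le> 6 * C2 * M * (M + \<epsilon>) * (M + \<epsilon>)"
    using assms by (intro norm_jacobiator_le norm_triangle_mono)
  finally show ?thesis
    by (simp add: delta_max_bar_def power2_eq_square mult.assoc)
qed

text \<open>
  For a common perturbation all three arguments of the Jacobiator change by \<open>x - z\<close>, so that
  multilinearity turns the trilinear bound into a Lipschitz estimate.
\<close>

lemma norm_projected_jacobiator_diff_le:
  assumes L: "quasi_lie_bracket L C2" "t \<ge> 0"
    and M: "norm x \<le> M" "norm z \<le> M"
    and \<epsilon>: "norm \<xi>1 \<le> \<epsilon>" "norm \<xi>2 \<le> \<epsilon>"
  shows "norm (projected_jacobiator L B t x (\<xi>1, \<xi>2) - projected_jacobiator L B t z (\<xi>1, \<xi>2))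
    \<le> rho_delta C2 M \<epsilon> * norm (x - z)"
proof -
  let ?J = "jacobiator L t" and ?d = "norm (x - z)"
  have bil: "bilinear (\<lambda>x y. L x y t)"
    using L unfolding quasi_lie_bracket_def by blast
  have "norm (projected_jacobiator L B t x (\<xi>1, \<xi>2) - projected_jacobiator L B t z (\<xi>1, \<xi>2))
      \<le> norm (?J x (x + \<xi>1) (x + \<xi>2) - ?J z (z + \<xi>1) (z + \<xi>2))"
    unfolding projected_jacobiator_def prod.case orth_proj_diff [OF subspace_image_matrix, symmetric]
    by (rule norm_orth_proj_le [OF subspace_image_matrix])
  also have "\<dots> = norm (?J (x - z) (x + \<xi>1) (x + \<xi>2) + ?J z (x - z) (x + \<xi>2)
      + ?J z (z + \<xi>1) (x - z))"
    using jacobiator_diff [of L t x "x + \<xi>1" "x + \<xi>2" z "z + \<xi>1" "z + \<xi>2", OF bil]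
    by simp
  also have "\<dots> \<le> 6 * C2 * ?d * (M + \<epsilon>) * (M + \<epsilon>) + 6 * C2 * M * ?d * (M + \<epsilon>)
      + 6 * C2 * M * (M + \<epsilon>) * ?d"
    using L M \<epsilon> by (intro norm_triangle_mono norm_jacobiator_le) auto
  also have "\<dots> = rho_delta C2 M \<epsilon> * ?d"
    by (simp add: rho_delta_def algebra_simps)
  finally show ?thesis .
qed

lemma rho_delta_nonneg: "C2 \<ge> 0 \<Longrightarrow> M \<ge> 0 \<Longrightarrow> \<epsilon> \<ge> 0 \<Longrightarrow> rho_delta C2 M \<epsilon> \<ge> 0"
  by (simp add: rho_delta_def)

lemma delta_max_bar_nonneg: "C2 \<ge> 0 \<Longrightarrow> M \<ge> 0 \<Longrightarrow> delta_max_bar C2 M \<epsilon> \<ge> 0"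
  by (simp add: delta_max_bar_def)

text \<open>
  A bound on the increment of \<open>\<delta>\<close> itself, combined with Cauchy--Schwarz, is stronger than the
  one-sided condition.
\<close>

lemma GOSL_I_norm:
  assumes "\<And>x z t. x \<in> X \<Longrightarrow> z \<in> X \<Longrightarrow> t \<ge> 0 \<Longrightarrow> norm (\<delta> x t - \<delta> z t) \<le> \<rho> * norm (x - z) + l"
  shows "GOSL X \<delta> \<rho> l"
  unfolding GOSL_def
proof (intro ballI allI impI)
  fix x z and t :: real
  assume "x \<in> X" "z \<in> X" "t \<ge> 0"
  have "(\<delta> x t - \<delta> z t) \<bullet> (x - z) \<le> norm (\<delta> x t - \<delta> z t) * norm (x - z)"
    by (rule norm_cauchy_schwarz)
  also have "\<dots> \<le> (\<rho> * norm (x - z) + l) * norm (x - z)"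
    using \<open>x \<in> X\<close> \<open>z \<in> X\<close> \<open>t \<ge> 0\<close> by (intro mult_right_mono assms) auto
  finally show "(\<delta> x t - \<delta> z t) \<bullet> (x - z) \<le> \<rho> * (norm (x - z))\<^sup>2 + l * norm (x - z)"
    by (simp add: power2_eq_square algebra_simps)
qed

lemma GOSL_jacobi_defect:
  assumes L: "quasi_lie_bracket L C2"
    and X: "\<And>x. x \<in> X \<Longrightarrow> norm x \<le> M" "\<And>x. x \<in> X \<Longrightarrow> norm x \<le> Mprior"
    and \<xi>: "\<And>x t. x \<in> X \<Longrightarrow> t \<ge> 0 \<Longrightarrow> norm (fst (\<xi> x t)) \<le> \<epsilon> \<and> norm (snd (\<xi> x t)) \<le> \<epsilon>"
  shows "GOSL X (jacobi_defect L B \<xi>) (2 * rho_delta C2 M \<epsilon>) (4 * delta_max_bar C2 Mprior \<epsilon>)"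
proof (rule GOSL_I_norm)
  fix x z and t :: real
  assume *: "x \<in> X" "z \<in> X" "t \<ge> 0"
  have size: "norm (jacobi_defect L B \<xi> y t) \<le> delta_max_bar C2 Mprior \<epsilon>" if "y \<in> X" for y
    using norm_projected_jacobiator_le [OF L \<open>t \<ge> 0\<close> X(2) [OF that],
        of "fst (\<xi> y t)" \<epsilon> "snd (\<xi> y t)" B] \<xi> [OF that \<open>t \<ge> 0\<close>]
    by (simp add: jacobi_defect_def)
  have "M \<ge> 0" "Mprior \<ge> 0" "\<epsilon> \<ge> 0" "C2 \<ge> 0"
    using X [OF \<open>x \<in> X\<close>] \<xi> [OF \<open>x \<in> X\<close> \<open>t \<ge> 0\<close>] L
    by (auto simp: quasi_lie_bracket_def intro: order_trans [OF norm_ge_zero])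
  then have nonneg: "rho_delta C2 M \<epsilon> * norm (x - z) \<ge> 0" "delta_max_bar C2 Mprior \<epsilon> \<ge> 0"
    by (simp_all add: rho_delta_nonneg delta_max_bar_nonneg)
  have "norm (jacobi_defect L B \<xi> x t - jacobi_defect L B \<xi> z t)
      \<le> delta_max_bar C2 Mprior \<epsilon> + delta_max_bar C2 Mprior \<epsilon>"
    using * by (intro order_trans [OF norm_triangle_ineq4] add_mono size)
  then show "norm (jacobi_defect L B \<xi> x t - jacobi_defect L B \<xi> z t)
      \<le> 2 * rho_delta C2 M \<epsilon> * norm (x - z) + 4 * delta_max_bar C2 Mprior \<epsilon>"
    using nonneg by simp
qed

lemma GOSL_jacobi_defect_state_independent:
  assumes L: "quasi_lie_bracket L C2"
    and X: "\<And>x. x \<in> X \<Longrightarrow> norm x \<le> M" "\<And>x. x \<in> X \<Longrightarrow> norm x \<le> Mprior"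
    and \<xi>: "\<And>x t. x \<in> X \<Longrightarrow> t \<ge> 0 \<Longrightarrow> \<xi> x t = \<eta> t"
    and \<eta>: "\<And>x t. x \<in> X \<Longrightarrow> t \<ge> 0 \<Longrightarrow> norm (fst (\<eta> t)) \<le> \<epsilon> \<and> norm (snd (\<eta> t)) \<le> \<epsilon>"
  shows "GOSL X (jacobi_defect L B \<xi>) (rho_delta C2 M \<epsilon>) (delta_max_bar C2 Mprior \<epsilon>)"
proof (rule GOSL_I_norm)
  fix x z and t :: real
  assume *: "x \<in> X" "z \<in> X" "t \<ge> 0"
  have "norm (jacobi_defect L B \<xi> x t - jacobi_defect L B \<xi> z t)
      \<le> rho_delta C2 M \<epsilon> * norm (x - z)"
    using norm_projected_jacobiator_diff_le [OF L \<open>t \<ge> 0\<close> X(1) X(1),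
        of x z "fst (\<eta> t)" \<epsilon> "snd (\<eta> t)" B] * \<eta> [of x t]
    by (simp add: jacobi_defect_def \<xi>)
  moreover have "Mprior \<ge> 0" "C2 \<ge> 0"
    using X(2) [OF \<open>x \<in> X\<close>] L
    by (auto simp: quasi_lie_bracket_def intro: order_trans [OF norm_ge_zero])
  ultimately show "norm (jacobi_defect L B \<xi> x t - jacobi_defect L B \<xi> z t)
      \<le> rho_delta C2 M \<epsilon> * norm (x - z) + delta_max_bar C2 Mprior \<epsilon>"
    by (smt (verit) delta_max_bar_nonneg)
qed

lemma is_maximizer_norm_le:
  "is_maximizer L B \<epsilon> t x p \<Longrightarrow> norm (fst p) \<le> \<epsilon> \<and> norm (snd p) \<le> \<epsilon>"
  by (auto simp: is_maximizer_def is_arg_max_def)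

theorem lemma2p8:
  fixes L :: "('n::finite) bracket"
    and B :: "quat ^ 'm::finite ^ 'n"
    and \<xi> :: "quat ^ 'n \<Rightarrow> real \<Rightarrow> (quat ^ 'n) \<times> (quat ^ 'n)"
    and A C1 C2 \<epsilon>0 \<epsilon> M Mprior :: real
    and X :: "(quat ^ 'n) set"
  assumes "quasi_lie_bracket L C2"
    and "bracket_constants L A C1 \<epsilon>0"
    and "\<epsilon> = eps_star A C1 C2 \<epsilon>0"
    and "caratheodory L"
    and "column_rank B = CARD('m)"
    and "maximizing_selection L B \<epsilon> \<xi>"
    and "X = cball 0 M"
    and "\<forall>x\<in>X. norm x \<le> Mprior"
  shows "GOSL X (jacobi_defect L B \<xi>)
             (2 * rho_delta C2 M \<epsilon>) (4 * delta_max_bar C2 Mprior \<epsilon>) \<and>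
         (\<forall>\<eta>. (\<forall>x\<in>X. \<forall>t\<ge>0. \<xi> x t = \<eta> t) \<longrightarrow>
           GOSL X (jacobi_defect L B \<xi>)
             (rho_delta C2 M \<epsilon>) (delta_max_bar C2 Mprior \<epsilon>)) \<and>
         (\<forall>\<eta>. (\<forall>x\<in>X. \<forall>t\<ge>0. is_maximizer L B \<epsilon> t x (\<eta> t)) \<longrightarrow>
           GOSL X (jacobi_defect L B (\<lambda>x. \<eta>))
             (rho_delta C2 M \<epsilon>) (delta_max_bar C2 Mprior \<epsilon>))"
proof (intro conjI allI impI)
  have X: "norm x \<le> M" "norm x \<le> Mprior" if "x \<in> X" for x
    using assms(7,8) that by auto
  have \<xi>: "norm (fst (\<xi> x t)) \<le> \<epsilon> \<and> norm (snd (\<xi> x t)) \<le> \<epsilon>" if "t \<ge> 0" for x t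
  proof (rule is_maximizer_norm_le)
    show "is_maximizer L B \<epsilon> t x (\<xi> x t)"
      using assms(6) that by (simp add: maximizing_selection_def)
  qed
  show "GOSL X (jacobi_defect L B \<xi>)
      (2 * rho_delta C2 M \<epsilon>) (4 * delta_max_bar C2 Mprior \<epsilon>)"
    by (rule GOSL_jacobi_defect [OF assms(1) X \<xi>])
  show "GOSL X (jacobi_defect L B \<xi>) (rho_delta C2 M \<epsilon>) (delta_max_bar C2 Mprior \<epsilon>)"
    if *: "\<forall>x\<in>X. \<forall>t\<ge>0. \<xi> x t = \<eta> t" for \<eta>
  proof (rule GOSL_jacobi_defect_state_independent [OF assms(1) X])
    show "\<xi> x t = \<eta> t" if "x \<in> X" "t \<ge> 0" for x t
      using * that by blast
    then show "norm (fst (\<eta> t)) \<le> \<epsilon> \<and> norm (snd (\<eta> t)) \<le> \<epsilon>" if "x \<in> X" "t \<ge> 0" for x t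
      using \<xi> [of t x] that by simp
  qed
  show "GOSL X (jacobi_defect L B (\<lambda>x. \<eta>)) (rho_delta C2 M \<epsilon>) (delta_max_bar C2 Mprior \<epsilon>)"
    if *: "\<forall>x\<in>X. \<forall>t\<ge>0. is_maximizer L B \<epsilon> t x (\<eta> t)" for \<eta>
  proof (rule GOSL_jacobi_defect_state_independent [OF assms(1) X refl])
    show "norm (fst (\<eta> t)) \<le> \<epsilon> \<and> norm (snd (\<eta> t)) \<le> \<epsilon>" if "x \<in> X" "t \<ge> 0" for x t
      using * that by (intro is_maximizer_norm_le [of L B \<epsilon> t x]) simp
  qed
qed

end
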